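(* Let $F(n)$ denote the number of 1-factorizations of the complete graph $K_n$ on the vertex set $[n]$. Then, as $n\to\infty$, $$ F(n) \leq \left( (1 + o(1)) \frac{n}{e^2} \right)^{\frac{n^2}{2}} ;$$ that is, there is a function $\varepsilon(n)\to 0$ as $n\to\infty$ such that $F(n) \le \left((1+\varepsilon(n))\frac{n}{e^2}\right)^{n^2/2}$ for every $n$.
   Context: A 1-factorization of $K_n$ is a partition of the edge set of $K_n$ into $n-1$ perfect matchings, equivalently a proper edge coloring of $K_n$ with $n-1$ colors (here the factorizations are counted as partitions of the labeled edge set, or equivalently as colorings with color set $[n-1]$, as in the paper's convention of coloring with colors $[n-1]$). A 1-factorization of $K_n$ exists if and only if $n$ is even; for odd $n$, $F(n)=0$. Here $e$ is the base of the natural logarithm. *)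

theory Defs
  imports Complex_Main "HOL-Library.Disjoint_Sets" "HOL-Library.Ramsey"
begin

definition complete_graph_edges :: "nat \<Rightarrow> nat set set" where
  "complete_graph_edges n = nsets {1..n} 2"

definition perfect_matching :: "'a set \<Rightarrow> 'a set set \<Rightarrow> 'a set set \<Rightarrow> bool" where
  "perfect_matching V E M \<longleftrightarrow> M \<subseteq> E \<and> (\<forall>v\<in>V. \<exists>!e. e \<in> M \<and> v \<in> e)"

text \<open>The number of classes is compared in the integers, so that there is no truncated
  subtraction at \<open>n = 0\<close>.\<close>
definition one_factorizations :: "nat \<Rightarrow> nat set set set set" where
  "one_factorizations n =
     {P. partition_on (complete_graph_edges n) P \<and> int (card P) = int n - 1 \<and>
         (\<forall>M\<in>P. perfect_matching {1..n} (complete_graph_edges n) M)}"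

definition F :: "nat \<Rightarrow> nat" where
  "F n = card (one_factorizations n)"

lemma finite_one_factorizations: "finite (one_factorizations n)"
proof (rule finite_subset)
  show "one_factorizations n \<subseteq> Pow (Pow (complete_graph_edges n))"
    by (auto simp: one_factorizations_def perfect_matching_def)
  show "finite (Pow (Pow (complete_graph_edges n)))"
    by (simp add: complete_graph_edges_def finite_imp_finite_nsets)
qed

end

theory Submission
  imports Defs "HOL-Real_Asymp.Real_Asymp"
begin

text \<open>Entropy argument of Linial and Luria, with the entropy replaced by counting. Fix an order
  on the edges and reveal a random colouring edge by edge; a colouring \<open>x\<close> that leaves
  \<open>N x e\<close> possibilities at each edge \<open>e\<close> is produced by the uniform greedy choice
  with probability \<open>\<Prod>e. 1 / N x e\<close>. These probabilities sum to at most 1, so by convexity the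
  logarithm of the number of colourings is at most the average of \<open>\<Sum>e. ln (N x e)\<close>. Now
  average over random orders: each edge receives an independent uniform label in \<open>{..<n}\<close>, and
  larger labels are revealed first. A colour \<open>c \<noteq> x e\<close> is still possible at \<open>e = {u, v}\<close> only
  if the \<open>c\<close>-coloured edges at \<open>u\<close> and at \<open>v\<close> have labels at most that of \<open>e\<close>, which for label
  \<open>j - 1\<close> has probability \<open>(j / n)\<^sup>2\<close>. By concavity of \<open>ln\<close>, each edge contributes at most
  the average of \<open>ln (1 + j\<^sup>2 / n)\<close> over \<open>j = 1..n\<close>, which is \<open>ln n - 2 + o(1)\<close>.\<close>

section \<open>Sequential revelation\<close>

text \<open>The comparison is strict, so edges tied with \<open>e\<close> count as still hidden.
  Ties can only enlarge the set, which lets labels be drawn from a finite set with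
  repetition.\<close>

definition choices :: "('e \<Rightarrow> 'c) set \<Rightarrow> 'e set \<Rightarrow> ('e \<Rightarrow> nat) \<Rightarrow> ('e \<Rightarrow> 'c) \<Rightarrow> 'e \<Rightarrow> 'c set" where
  "choices S E l x e = (\<lambda>y. y e) ` {y \<in> S. \<forall>d\<in>E. l e < l d \<longrightarrow> y d = x d}"

lemma finite_choices: "finite S \<Longrightarrow> finite (choices S E l x e)"
  by (simp add: choices_def)

lemma card_choices_pos: "finite S \<Longrightarrow> x \<in> S \<Longrightarrow> 0 < card (choices S E l x e)"
  by (auto simp: card_gt_0_iff finite_choices) (auto simp: choices_def)

text \<open>Induction adds an edge \<open>e0\<close> of largest label, the one revealed first. Its
  value splits \<open>S\<close> into fibres of weight \<open>1 / card K\<close>, and the induction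
  hypothesis bounds the sum over each fibre by 1.\<close>

lemma sum_prod_inverse_choices_le_1:
  fixes l :: "'e \<Rightarrow> nat" and S :: "('e \<Rightarrow> 'c) set"
  assumes "finite E" "finite S"
    and "\<And>x y. x \<in> S \<Longrightarrow> y \<in> S \<Longrightarrow> (\<And>e. e \<in> E \<Longrightarrow> x e = y e) \<Longrightarrow> x = y"
  shows "(\<Sum>x\<in>S. \<Prod>e\<in>E. 1 / real (card (choices S E l x e))) \<le> 1"
  using assms
proof (induction E arbitrary: S rule: finite_ranking_induct[where f = l])
  case empty
  then have "\<And>x y. x \<in> S \<Longrightarrow> y \<in> S \<Longrightarrow> x = y" by blast
  then have "card S \<le> 1" using empty.prems(1) by (simp add: card_le_Suc0_iff_eq)
  then show ?case by simp
next
  case (insert e0 E)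
  show ?case
  proof (cases "e0 \<in> E")
    case True
    then show ?thesis using insert.IH[OF insert.prems(1)] insert.prems(2) by (simp add: insert_absorb)
  next
    case False
    define K where "K = (\<lambda>y. y e0) ` S"
    define T where "T a = {y \<in> S. y e0 = a}" for a
    have finK: "finite K" unfolding K_def using insert.prems by simp
    \<comment> \<open>No label exceeds that of \<open>e0\<close>, so nothing is revealed before
      it.\<close>
    have first: "choices S (insert e0 E) l x e0 = K" for x
    proof -
      have "{y \<in> S. \<forall>d\<in>insert e0 E. l e0 < l d \<longrightarrow> y d = x d} = S"
        using insert.hyps(2) by (auto simp: not_less[symmetric])
      then show ?thesis by (simp add: choices_def K_def)
    qed
    \<comment> \<open>Members of \<open>T a\<close> already agree at \<open>e0\<close>, so
      restricting to the fibre can only shrink the choices and enlarge the reciprocals.\<close>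
    have mono: "(\<Prod>e\<in>E. 1 / real (card (choices S (insert e0 E) l x e)))
        \<le> (\<Prod>e\<in>E. 1 / real (card (choices (T a) E l x e)))" if x: "x \<in> T a" for a x
    proof (rule prod_mono, intro conjI)
      fix e assume "e \<in> E"
      have sub: "choices (T a) E l x e \<subseteq> choices S (insert e0 E) l x e"
        using x by (fastforce simp: choices_def T_def)
      have fT: "finite (T a)" using insert.prems(1) by (simp add: T_def)
      have "card (choices (T a) E l x e) \<le> card (choices S (insert e0 E) l x e)"
        using sub insert.prems(1) by (intro card_mono finite_choices)
      moreover have "0 < card (choices (T a) E l x e)" by (rule card_choices_pos[OF fT x])
      ultimately show "1 / real (card (choices S (insert e0 E) l x e))
          \<le> 1 / real (card (choices (T a) E l x e))"
        by (intro divide_left_mono) auto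
    qed simp
    have IH: "(\<Sum>x\<in>T a. \<Prod>e\<in>E. 1 / real (card (choices (T a) E l x e))) \<le> 1" for a
    proof (rule insert.IH)
      show "finite (T a)" using insert.prems(1) by (simp add: T_def)
      fix x y assume xy: "x \<in> T a" "y \<in> T a" "\<And>e. e \<in> E \<Longrightarrow> x e = y e"
      then have "x e = y e" if "e \<in> insert e0 E" for e using that by (auto simp: T_def)
      then show "x = y" using insert.prems(2)[of x y] xy by (simp add: T_def)
    qed
    have "(\<Sum>x\<in>S. \<Prod>e\<in>insert e0 E. 1 / real (card (choices S (insert e0 E) l x e)))
        = (\<Sum>x\<in>S. 1 / card K * (\<Prod>e\<in>E. 1 / real (card (choices S (insert e0 E) l x e))))"
      using False insert.hyps(1) by (simp add: first)
    also have "\<dots> = (\<Sum>a\<in>K. \<Sum>x\<in>T a.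
          1 / card K * (\<Prod>e\<in>E. 1 / real (card (choices S (insert e0 E) l x e))))"
      unfolding T_def by (rule sum.group[symmetric]) (use insert.prems(1) finK in \<open>auto simp: K_def\<close>)
    also have "\<dots> \<le> (\<Sum>a\<in>K. \<Sum>x\<in>T a.
          1 / card K * (\<Prod>e\<in>E. 1 / real (card (choices (T a) E l x e))))"
      by (intro sum_mono mult_left_mono mono) auto
    also have "\<dots> = (\<Sum>a\<in>K. 1 / card K * (\<Sum>x\<in>T a. (\<Prod>e\<in>E. 1 / real (card (choices (T a) E l x e)))))"
      by (simp add: sum_distrib_left)
    also have "\<dots> \<le> (\<Sum>a\<in>K. 1 / card K * 1)"
      by (intro sum_mono mult_left_mono IH) auto
    also have "\<dots> \<le> 1" by simp
    finally show ?thesis .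
  qed
qed

text \<open>A Gibbs inequality: sum \<open>1 + t <= exp t\<close> at
  \<open>t = ln (card S) - s x\<close>. Equality holds when \<open>s\<close> is constantly
  \<open>ln (card S)\<close>.\<close>

lemma card_mult_ln_card_le:
  fixes s :: "'a \<Rightarrow> real"
  assumes "finite S" "S \<noteq> {}" "(\<Sum>x\<in>S. exp (- s x)) \<le> 1"
  shows "card S * ln (card S) \<le> (\<Sum>x\<in>S. s x)"
proof -
  have pos: "0 < real (card S)" using assms by (simp add: card_gt_0_iff)
  define L where "L = ln (real (card S))"
  have "(\<Sum>x\<in>S. 1 + (L - s x)) \<le> (\<Sum>x\<in>S. exp (L - s x))"
    by (intro sum_mono exp_ge_add_one_self)
  also have "\<dots> = card S * (\<Sum>x\<in>S. exp (- s x))"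
    using pos by (simp add: sum_distrib_left L_def exp_diff exp_minus divide_inverse)
  also have "\<dots> \<le> real (card S) * 1" using assms(3) by (intro mult_left_mono) auto
  finally show ?thesis by (simp add: sum.distrib sum_subtractf L_def)
qed

lemma card_mult_ln_card_le_sum_choices:
  fixes l :: "'e \<Rightarrow> nat" and S :: "('e \<Rightarrow> 'c) set"
  assumes "finite E" "finite S" "S \<noteq> {}"
    and ext: "\<And>x y. x \<in> S \<Longrightarrow> y \<in> S \<Longrightarrow> (\<And>e. e \<in> E \<Longrightarrow> x e = y e) \<Longrightarrow> x = y"
  shows "card S * ln (card S) \<le> (\<Sum>x\<in>S. \<Sum>e\<in>E. ln (card (choices S E l x e)))"
proof (rule card_mult_ln_card_le[OF assms(2,3)])
  have "(\<Sum>x\<in>S. exp (- (\<Sum>e\<in>E. ln (card (choices S E l x e)))))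
      = (\<Sum>x\<in>S. \<Prod>e\<in>E. 1 / real (card (choices S E l x e)))"
    using assms card_choices_pos[OF assms(2)]
    by (intro sum.cong refl)
      (simp add: exp_minus exp_sum prod_inversef[symmetric] divide_inverse)
  also have "\<dots> \<le> 1" by (rule sum_prod_inverse_choices_le_1[OF assms(1,2) ext])
  finally show "(\<Sum>x\<in>S. exp (- (\<Sum>e\<in>E. ln (card (choices S E l x e))))) \<le> 1" .
qed

section \<open>Random labels\<close>

lemma card_labels_fixed:
  assumes "finite E" "e \<in> E" "j < M"
  shows "card {l \<in> E \<rightarrow>\<^sub>E {..<M}. l e = j} = M ^ (card E - 1)"
proof -
  have "{l \<in> E \<rightarrow>\<^sub>E {..<M}. l e = j} = (\<Pi>\<^sub>E d\<in>E. if d = e then {j} else {..<M})"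
    using assms by (auto simp: PiE_iff extensional_def split: if_splits)
  then have "card {l \<in> E \<rightarrow>\<^sub>E {..<M}. l e = j} = (\<Prod>d\<in>E. card (if d = e then {j} else {..<M}))"
    using assms by (simp add: card_PiE)
  also have "\<dots> = (\<Prod>d\<in>E - {e}. M)"
    using assms by (subst prod.remove[of E e]) (auto intro!: prod.cong)
  finally show ?thesis using assms by simp
qed

text \<open>Since the three edges are distinct, the labellings form a product set. Among the
  \<open>M ^ (card E - 1)\<close> labellings with \<open>l e = j\<close>, the other two conditions
  are independent, each of probability \<open>Suc j / M\<close>.\<close>

lemma card_labels_le:
  assumes "finite E" "e \<in> E" "f \<in> E" "g \<in> E" "e \<noteq> f" "e \<noteq> g" "f \<noteq> g" "j < M"
  shows "real (card {l \<in> E \<rightarrow>\<^sub>E {..<M}. l e = j \<and> l f \<le> j \<and> l g \<le> j})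
    = real (M ^ (card E - 1)) * (real (Suc j) / real M)\<^sup>2"
proof -
  let ?B = "\<lambda>d. if d = e then {j} else if d = f \<or> d = g then {..j} else {..<M}"
  have "{l \<in> E \<rightarrow>\<^sub>E {..<M}. l e = j \<and> l f \<le> j \<and> l g \<le> j} = (\<Pi>\<^sub>E d\<in>E. ?B d)" (is "?L = ?R")
  proof
    show "?L \<subseteq> ?R" using assms by (auto simp: PiE_iff extensional_def)
    show "?R \<subseteq> ?L"
    proof
      fix l assume l: "l \<in> ?R"
      have "l d < M" if "d \<in> E" for d
        using PiE_mem[OF l that] assms(8) by (auto split: if_splits)
      then show "l \<in> ?L"
        using PiE_mem[OF l assms(2)] PiE_mem[OF l assms(3)] PiE_mem[OF l assms(4)] assms l
        by (auto simp: PiE_iff)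
    qed
  qed
  then have "card {l \<in> E \<rightarrow>\<^sub>E {..<M}. l e = j \<and> l f \<le> j \<and> l g \<le> j} = (\<Prod>d\<in>E. card (?B d))"
    using assms by (simp add: card_PiE)
  also have "\<dots> = (\<Prod>d\<in>{e, f, g}. card (?B d)) * (\<Prod>d\<in>E - {e, f, g}. card (?B d))"
    using assms by (subst mult.commute, intro prod.subset_diff) auto
  also have "(\<Prod>d\<in>{e, f, g}. card (?B d)) = Suc j * Suc j" using assms by simp
  also have "(\<Prod>d\<in>E - {e, f, g}. card (?B d)) = (\<Prod>d\<in>E - {e, f, g}. M)"
    by (intro prod.cong) auto
  also have "\<dots> = M ^ (card E - 3)" using assms by (simp add: card_Diff_subset numeral_3_eq_3)
  finally have c: "card {l \<in> E \<rightarrow>\<^sub>E {..<M}. l e = j \<and> l f \<le> j \<and> l g \<le> j}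
      = Suc j * Suc j * M ^ (card E - 3)" .
  have "card {e, f, g} \<le> card E" using assms by (intro card_mono) auto
  \<comment> \<open>Three distinct edges force \<open>card E >= 3\<close>, so the truncated
    subtractions are exact.\<close>
  then have "card E - 1 = (card E - 3) + 2" using assms by simp
  then have "M ^ (card E - 1) = M ^ (card E - 3) * M\<^sup>2" by (simp add: power_add power2_eq_square)
  then show ?thesis using c assms(8) by (simp add: field_simps power2_eq_square)
qed

section \<open>Edge colourings of the complete graph\<close>

text \<open>The summand for \<open>j\<close> bounds the log of the expected number of choices at an
  edge labelled \<open>j\<close>: 1 for its own colour, plus at most \<open>n\<close> other colours,
  each surviving with probability \<open>(Suc j / n)^2\<close>.\<close>

abbreviation mean_log :: "nat \<Rightarrow> real" where
  "mean_log n \<equiv> (\<Sum>j<n. ln (1 + (real (Suc j))\<^sup>2 / real n)) / real n"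

text \<open>Unique existence encodes properness and perfect matchings at once. Extensionality makes
  a colouring determined by its values on the edges, as the counting bound requires.\<close>

definition factor_colourings :: "nat \<Rightarrow> (nat set \<Rightarrow> nat) set" where
  "factor_colourings n = {x \<in> complete_graph_edges n \<rightarrow>\<^sub>E {..<n - 1}.
     \<forall>v\<in>{1..n}. \<forall>c<n - 1. \<exists>!e. e \<in> complete_graph_edges n \<and> v \<in> e \<and> x e = c}"

lemma finite_complete_graph_edges: "finite (complete_graph_edges n)"
  by (simp add: complete_graph_edges_def finite_imp_finite_nsets)

lemma finite_factor_colourings: "finite (factor_colourings n)"
  unfolding factor_colourings_def
  by (rule finite_subset[OF _ finite_PiE[OF finite_complete_graph_edges, of n "\<lambda>_. {..<n - 1}"]]) auto

text \<open>Numbering the classes gives a colouring from which the factorization is recovered.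
  Overcounting by \<open>(n - 1)!\<close> is harmless, as its power \<open>2 / n^2\<close> tends to
  1.\<close>

lemma F_le_card_factor_colourings:
  assumes "n \<ge> 1"
  shows "F n \<le> card (factor_colourings n)"
proof -
  let ?E = "complete_graph_edges n"
  define classes where "classes x = (\<lambda>k. {e \<in> ?E. x e = k}) ` {..<n - 1}" for x :: "nat set \<Rightarrow> nat"
  have "one_factorizations n \<subseteq> classes ` factor_colourings n"
  proof
    fix P assume "P \<in> one_factorizations n"
    then have part: "partition_on ?E P" and cardP: "int (card P) = int n - 1"
      and pm: "\<And>M. M \<in> P \<Longrightarrow> perfect_matching {1..n} ?E M"
      by (auto simp: one_factorizations_def)
    have finP: "finite P" by (rule finite_elements[OF finite_complete_graph_edges part])
    \<comment> \<open>For \<open>n >= 1\<close> the natural number \<open>n - 1\<close> agrees with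
      the integer one.\<close>
    have "card P = card {..<n - 1}" using cardP assms by simp
    then obtain h where h: "bij_betw h P {..<n - 1}"
      using finite_same_card_bij[OF finP finite_lessThan] by blast
    define x where "x = (\<lambda>e\<in>?E. h (THE M. M \<in> P \<and> e \<in> M))"
    have the: "(THE M. M \<in> P \<and> e \<in> M) = M" if "M \<in> P" "e \<in> M" for e M
      using that partition_onD2[OF part] by (intro the_equality) (auto simp: disjoint_def)
    have sub: "M \<subseteq> ?E" if "M \<in> P" for M using that partition_onD1[OF part] by auto
    have xM: "x e = h M" if "M \<in> P" "e \<in> M" for e M
      using the[OF that] that sub by (auto simp: x_def)
    have ex: "\<exists>M\<in>P. e \<in> M" if "e \<in> ?E" for e using that partition_onD1[OF part] by auto
    \<comment> \<open>Injectivity of \<open>h\<close> keeps two matchings from merging into one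
      colour class.\<close>
    have cls: "e \<in> M \<longleftrightarrow> e \<in> ?E \<and> x e = h M" if M: "M \<in> P" for e M
    proof
      assume "e \<in> M" then show "e \<in> ?E \<and> x e = h M" using xM sub M by auto
    next
      assume e: "e \<in> ?E \<and> x e = h M"
      then obtain M' where M': "M' \<in> P" "e \<in> M'" using ex by blast
      then have "h M' = h M" using xM e by auto
      then have "M' = M" using h M M' by (auto simp: bij_betw_def dest: inj_onD)
      then show "e \<in> M" using M' by simp
    qed
    have "x \<in> factor_colourings n"
      unfolding factor_colourings_def
    proof (intro CollectI conjI ballI allI impI)
      have "x e \<in> {..<n - 1}" if "e \<in> ?E" for e
        using ex[OF that] xM h by (auto simp: bij_betw_def)
      then show "x \<in> ?E \<rightarrow>\<^sub>E {..<n - 1}" by (auto simp: PiE_iff x_def)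
      fix v c assume v: "v \<in> {1..n}" and "c < n - 1"
      then have "c \<in> h ` P" using h by (simp add: bij_betw_def)
      then obtain M where M: "M \<in> P" "h M = c" by blast
      have "\<exists>!e. e \<in> M \<and> v \<in> e" using pm[OF M(1)] v by (auto simp: perfect_matching_def)
      then show "\<exists>!e. e \<in> ?E \<and> v \<in> e \<and> x e = c"
        using cls[OF M(1)] M(2) by (metis (no_types, lifting))
    qed
    moreover have "P = classes x"
    proof -
      have "{e \<in> ?E. x e = h M} = M" if "M \<in> P" for M using cls[OF that] by blast
      then have "P = (\<lambda>M. {e \<in> ?E. x e = h M}) ` P" by simp
      also have "\<dots> = classes x"
        unfolding classes_def bij_betw_imp_surj_on[OF h, symmetric] image_image ..
      finally show ?thesis .
    qed
    ultimately show "P \<in> classes ` factor_colourings n" by blast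
  qed
  then show ?thesis unfolding F_def by (rule surj_card_le[OF finite_factor_colourings])
qed

text \<open>With \<open>x\<close> and \<open>e\<close> fixed, the blocking edges \<open>f c\<close>
  and \<open>g c\<close> depend on \<open>x\<close> alone, so only independent labels remain to be
  counted.\<close>

lemma sum_labels_ln_card_choices_le:
  fixes n :: nat
  defines "E \<equiv> complete_graph_edges n" and "S \<equiv> factor_colourings n"
  assumes x: "x \<in> S" and e: "e \<in> E"
  shows "(\<Sum>l \<in> E \<rightarrow>\<^sub>E {..<n}. ln (card (choices S E l x e))) \<le> real (n ^ card E) * mean_log n"
proof -
  have finE: "finite E" unfolding E_def by (rule finite_complete_graph_edges)
  have finS: "finite S" unfolding S_def by (rule finite_factor_colourings)
  obtain u v where uv: "e = {u, v}" "u \<noteq> v" "u \<in> {1..n}" "v \<in> {1..n}"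
    using e by (auto simp: E_def complete_graph_edges_def nsets_def card_2_iff)
  have n2: "n \<ge> 2" using uv by auto
  have card2: "card d = 2" if "d \<in> E" for d
    using that by (auto simp: E_def complete_graph_edges_def nsets_def)
  define C where "C = {..<n - 1} - {x e}"
  have proper: "d = d'" if "y \<in> S" "w \<in> {1..n}" "d \<in> E" "d' \<in> E" "w \<in> d" "w \<in> d'" "y d = y d'"
    for y w d d'
  proof -
    have "y d < n - 1" using that by (auto simp: S_def E_def factor_colourings_def PiE_iff)
    then have "\<exists>!a. a \<in> E \<and> w \<in> a \<and> y a = y d"
      using that by (auto simp: S_def E_def factor_colourings_def)
    then show ?thesis using that by metis
  qed
  have ex: "\<forall>c<n - 1. \<exists>d. d \<in> E \<and> w \<in> d \<and> x d = c" if "w \<in> {1..n}" for w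
    using x that unfolding S_def E_def factor_colourings_def mem_Collect_eq by metis
  obtain f where f: "\<And>c. c < n - 1 \<Longrightarrow> f c \<in> E \<and> u \<in> f c \<and> x (f c) = c"
    using ex[OF uv(3)] by metis
  obtain g where g: "\<And>c. c < n - 1 \<Longrightarrow> g c \<in> E \<and> v \<in> g c \<and> x (g c) = c"
    using ex[OF uv(4)] by metis
  \<comment> \<open>Colours separate \<open>e\<close> from the other two edges; an edge equal to
    both \<open>f c\<close> and \<open>g c\<close> would contain \<open>u\<close> and
    \<open>v\<close> and hence be \<open>e\<close>.\<close>
  have distinct: "e \<noteq> f c" "e \<noteq> g c" "f c \<noteq> g c" if "c \<in> C" for c
  proof -
    have c: "c < n - 1" "c \<noteq> x e" using that by (auto simp: C_def)
    show 1: "e \<noteq> f c" and "e \<noteq> g c" using f[OF c(1)] g[OF c(1)] c(2) by auto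
    show "f c \<noteq> g c"
    proof
      assume "f c = g c"
      then have "e \<subseteq> f c" using f[OF c(1)] g[OF c(1)] uv by auto
      moreover have card: "card (f c) = 2" "card e = 2" using card2 f[OF c(1)] e by auto
      moreover have "finite (f c)" using card(1) by (intro card_ge_0_finite) simp
      ultimately show False using card_subset_eq 1 by metis
    qed
  qed
  define A where "A l = {c \<in> C. l (f c) \<le> l e \<and> l (g c) \<le> l e}" for l :: "nat set \<Rightarrow> nat"
  \<comment> \<open>If \<open>f c\<close> or \<open>g c\<close> is revealed before \<open>e\<close>,
    every compatible \<open>y\<close> gives it colour \<open>c\<close> too, so
    \<open>y e = c\<close> would clash at \<open>u\<close> or \<open>v\<close>.\<close>
  have choices_sub: "choices S E l x e \<subseteq> insert (x e) (A l)" for l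
  proof
    fix c assume "c \<in> choices S E l x e"
    then obtain y where y: "y \<in> S" "c = y e" "\<And>d. d \<in> E \<Longrightarrow> l e < l d \<Longrightarrow> y d = x d"
      by (auto simp: choices_def)
    show "c \<in> insert (x e) (A l)"
    proof (cases "c = x e")
      case False
      have "c < n - 1" using y e by (auto simp: S_def E_def factor_colourings_def PiE_iff)
      then have c: "c \<in> C" using False by (simp add: C_def)
      have "\<not> l e < l (f c)"
      proof
        assume "l e < l (f c)"
        then have "y (f c) = y e" using y f[OF \<open>c < n - 1\<close>] by auto
        then have "f c = e" using proper[of y u "f c" e] y f[OF \<open>c < n - 1\<close>] uv e by auto
        then show False using distinct(1)[OF c] by simp
      qed
      moreover have "\<not> l e < l (g c)"
      proof
        assume "l e < l (g c)"
        then have "y (g c) = y e" using y g[OF \<open>c < n - 1\<close>] by auto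
        then have "g c = e" using proper[of y v "g c" e] y g[OF \<open>c < n - 1\<close>] uv e by auto
        then show False using distinct(2)[OF c] by simp
      qed
      ultimately show ?thesis using c by (auto simp: A_def)
    qed simp
  qed
  have finC: "finite C" "card C \<le> n"
    by (auto simp: C_def intro: order_trans[OF card_Diff1_le])
  have card_choices: "real (card (choices S E l x e)) \<le> 1 + card (A l)" for l
  proof -
    have "finite (A l)" using finC by (simp add: A_def)
    then have "card (choices S E l x e) \<le> card (insert (x e) (A l))"
      by (intro card_mono choices_sub) auto
    also have "\<dots> \<le> Suc (card (A l))" by (rule card_insert_le_m1) auto
    finally show ?thesis by simp
  qed
  define L where "L j = {l \<in> E \<rightarrow>\<^sub>E {..<n}. l e = j}" for j
  define m where "m = n ^ (card E - 1)"
  have finL: "finite (L j)" for j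
    unfolding L_def by (rule finite_subset[OF _ finite_PiE[OF finE, of "\<lambda>_. {..<n}"]]) auto
  have bound: "(\<Sum>l\<in>L j. ln (card (choices S E l x e))) \<le> real m * ln (1 + (real (Suc j))\<^sup>2 / real n)"
    if j: "j < n" for j
  proof -
    \<comment> \<open>\<open>B\<close> bounds the mean of \<open>1 + card (A l)\<close> over
      \<open>L j\<close>.\<close>
    define B where "B = 1 + (real (Suc j))\<^sup>2 / real n"
    have B: "B \<ge> 1" by (simp add: B_def)
    have cL: "card (L j) = m" unfolding L_def m_def by (rule card_labels_fixed[OF finE e j])
    have "(\<Sum>l\<in>L j. card (A l)) = (\<Sum>l\<in>L j. \<Sum>c\<in>C. if l (f c) \<le> j \<and> l (g c) \<le> j then 1 else 0)"
    proof (rule sum.cong[OF refl])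
      fix l assume "l \<in> L j"
      then have "l e = j" by (simp add: L_def)
      then show "card (A l) = (\<Sum>c\<in>C. if l (f c) \<le> j \<and> l (g c) \<le> j then 1 else 0)"
        using finC by (simp add: A_def sum.If_cases Int_def)
    qed
    \<comment> \<open>Double counting: for each colour, count the labellings that leave it
      available.\<close>
    also have "\<dots> = (\<Sum>c\<in>C. \<Sum>l\<in>L j. if l (f c) \<le> j \<and> l (g c) \<le> j then 1 else 0)"
      by (rule sum.swap)
    also have "\<dots> = (\<Sum>c\<in>C. card {l \<in> L j. l (f c) \<le> j \<and> l (g c) \<le> j})"
      using finL by (simp add: sum.If_cases Int_def)
    finally have "real (\<Sum>l\<in>L j. card (A l))
        = (\<Sum>c\<in>C. real (card {l \<in> L j. l (f c) \<le> j \<and> l (g c) \<le> j}))" by simp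
    also have "\<dots> = (\<Sum>c\<in>C. real m * (real (Suc j) / real n)\<^sup>2)"
    proof (rule sum.cong[OF refl])
      fix c assume c: "c \<in> C"
      then have "c < n - 1" by (simp add: C_def)
      have "{l \<in> L j. l (f c) \<le> j \<and> l (g c) \<le> j}
          = {l \<in> E \<rightarrow>\<^sub>E {..<n}. l e = j \<and> l (f c) \<le> j \<and> l (g c) \<le> j}" by (auto simp: L_def)
      then show "real (card {l \<in> L j. l (f c) \<le> j \<and> l (g c) \<le> j}) = real m * (real (Suc j) / real n)\<^sup>2"
        using card_labels_le[OF finE e _ _ distinct[OF c] j] f[OF \<open>c < n - 1\<close>] g[OF \<open>c < n - 1\<close>]
        by (simp add: m_def)
    qed
    also have "\<dots> \<le> real n * (real m * (real (Suc j) / real n)\<^sup>2)"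
      using finC(2) by (simp add: mult_right_mono del: of_nat_Suc)
    also have "\<dots> = real m * (B - 1)"
      using n2 by (simp add: B_def power2_eq_square field_simps)
    finally have sumA: "(\<Sum>l\<in>L j. real (card (A l))) \<le> real m * (B - 1)" by simp
    text \<open>Jensen for \<open>ln\<close>, via its tangent at the bound \<open>B\<close> on the mean.\<close>
    have "(\<Sum>l\<in>L j. ln (card (choices S E l x e))) \<le> (\<Sum>l\<in>L j. ln B + ((1 + real (card (A l))) / B - 1))"
    proof (rule sum_mono)
      fix l
      have "0 < real (card (choices S E l x e))" using card_choices_pos[OF finS x] by simp
      then have "ln (card (choices S E l x e)) \<le> ln (1 + real (card (A l)))"
        using card_choices[of l] by (intro ln_mono) auto
      also have "\<dots> = ln B + ln ((1 + real (card (A l))) / B)"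
        using B by (simp add: ln_div)
      also have "\<dots> \<le> ln B + ((1 + real (card (A l))) / B - 1)"
        using B by (intro add_left_mono ln_le_minus_one divide_pos_pos) auto
      finally show "ln (card (choices S E l x e)) \<le> ln B + ((1 + real (card (A l))) / B - 1)" .
    qed
    also have "\<dots> = real m * ln B + (real m + (\<Sum>l\<in>L j. real (card (A l)))) / B - real m"
      by (simp add: sum.distrib sum_subtractf sum_divide_distrib[symmetric] cL)
    also have "\<dots> \<le> real m * ln B + (real m + real m * (B - 1)) / B - real m"
      using sumA B by (intro diff_right_mono add_left_mono divide_right_mono) auto
    also have "\<dots> = real m * ln B" using B by (simp add: field_simps)
    finally show ?thesis unfolding B_def .
  qed
  have "(\<Sum>l \<in> E \<rightarrow>\<^sub>E {..<n}. ln (card (choices S E l x e)))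
      = (\<Sum>j<n. \<Sum>l\<in>L j. ln (card (choices S E l x e)))"
    unfolding L_def by (rule sum.group[symmetric]) (use finE e in \<open>auto intro!: finite_PiE\<close>)
  also have "\<dots> \<le> (\<Sum>j<n. real m * ln (1 + (real (Suc j))\<^sup>2 / real n))"
    by (intro sum_mono bound) auto
  also have "\<dots> = real m * (\<Sum>j<n. ln (1 + (real (Suc j))\<^sup>2 / real n))"
    by (simp add: sum_distrib_left)
  also have "\<dots> = real (n ^ card E) * mean_log n"
  proof -
    \<comment> \<open>\<open>E\<close> contains \<open>e\<close>, so one factor \<open>n\<close> can
      be split off; it cancels the denominator of \<open>mean_log\<close>.\<close>
    have "card E = Suc (card E - 1)" using finE e by (metis card_Suc_Diff1 card_Diff_singleton)
    then have "n ^ card E = n * m" unfolding m_def by (metis power_Suc)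
    then show ?thesis using n2 by simp
  qed
  finally show ?thesis .
qed

lemma mean_log_nonneg: "mean_log n \<ge> 0"
  by (intro divide_nonneg_nonneg sum_nonneg ln_ge_zero) auto

text \<open>The sequential bound holds for each labelling. It is summed over all of them, and the
  common positive factor is cancelled at the end.\<close>

lemma ln_card_factor_colourings_le:
  assumes "n \<ge> 1" "factor_colourings n \<noteq> {}"
  shows "ln (card (factor_colourings n)) \<le> (real n)\<^sup>2 / 2 * mean_log n"
proof -
  let ?E = "complete_graph_edges n" and ?S = "factor_colourings n"
  let ?L = "?E \<rightarrow>\<^sub>E {..<n}"
  have finE: "finite ?E" by (rule finite_complete_graph_edges)
  have finS: "finite ?S" by (rule finite_factor_colourings)
  have cL: "card ?L = n ^ card ?E" using finE by (simp add: card_PiE)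
  have pos: "0 < real (n ^ card ?E * card ?S)" using assms finS by (simp add: card_gt_0_iff)
  have "real (n ^ card ?E * card ?S) * ln (card ?S) = (\<Sum>l\<in>?L. card ?S * ln (card ?S))"
    by (simp add: cL)
  also have "\<dots> \<le> (\<Sum>l\<in>?L. \<Sum>x\<in>?S. \<Sum>e\<in>?E. ln (card (choices ?S ?E l x e)))"
  proof (intro sum_mono card_mult_ln_card_le_sum_choices finE finS assms)
    fix x y assume "x \<in> ?S" "y \<in> ?S" "\<And>e. e \<in> ?E \<Longrightarrow> x e = y e"
    then show "x = y" by (auto simp: factor_colourings_def intro: PiE_ext)
  qed
  \<comment> \<open>The sum over labels goes innermost, so that each pair of colouring and edge can
    be treated separately.\<close>
  also have "\<dots> = (\<Sum>x\<in>?S. \<Sum>e\<in>?E. \<Sum>l\<in>?L. ln (card (choices ?S ?E l x e)))"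
    by (subst sum.swap, intro sum.cong refl, rule sum.swap)
  also have "\<dots> \<le> (\<Sum>x\<in>?S. \<Sum>e\<in>?E. real (n ^ card ?E) * mean_log n)"
    by (intro sum_mono sum_labels_ln_card_choices_le)
  also have "\<dots> = real (n ^ card ?E * card ?S) * (card ?E * mean_log n)"
    by simp
  finally have "ln (card ?S) \<le> card ?E * mean_log n" using pos by (simp only: mult_le_cancel_left_pos)
  also have "\<dots> \<le> (real n)\<^sup>2 / 2 * mean_log n"
  proof (intro mult_right_mono mean_log_nonneg)
    have "card ?E = n choose 2" by (simp add: complete_graph_edges_def)
    also have "2 * \<dots> \<le> n * (n - 1)" unfolding choose_two by simp
    also have "\<dots> \<le> n * n" by simp
    finally have "2 * card ?E \<le> n * n" .
    then have "real (2 * card ?E) \<le> real (n * n)" by (simp only: of_nat_le_iff)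
    then show "real (card ?E) \<le> (real n)\<^sup>2 / 2" by (simp add: power2_eq_square)
  qed
  finally show ?thesis .
qed

section \<open>Asymptotics\<close>

lemma inverse_Suc_le_ln_diff:
  assumes "n \<ge> 1"
  shows "1 / real (Suc n) \<le> ln (real (Suc n)) - ln (real n)"
proof -
  have "ln (real n / real (Suc n)) \<le> real n / real (Suc n) - 1"
    using assms by (intro ln_le_minus_one) auto
  then show ?thesis using assms by (simp add: ln_div field_simps)
qed

lemma sum_inverse_le_ln:
  assumes "n \<ge> 1"
  shows "(\<Sum>j<n. 1 / real (Suc j)) \<le> 1 + ln (real n)"
  using assms
proof (induction n rule: dec_induct)
  case (step n)
  then show ?case using inverse_Suc_le_ln_diff[of n] by simp
qed simp

text \<open>A weak Stirling bound, \<open>n! <= e * n * (n / e)^n\<close>. The error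
  \<open>1 + ln n\<close> vanishes after division by \<open>n\<close>.\<close>

lemma sum_ln_le:
  assumes "n \<ge> 1"
  shows "(\<Sum>j<n. ln (real (Suc j))) \<le> real n * ln (real n) - real n + 1 + ln (real n)"
  using assms
proof (induction n rule: dec_induct)
  case (step n)
  have "1 \<le> real (Suc n) * (ln (real (Suc n)) - ln (real n))"
    using inverse_Suc_le_ln_diff[OF step(1)] by (simp add: field_simps)
  then show ?case using step.IH by (simp add: algebra_simps)
qed simp

lemma sum_ln_ge:
  assumes "n \<ge> 1"
  shows "real n * ln (real n) - real n \<le> (\<Sum>j<n. ln (real (Suc j)))"
  using assms
proof (induction n rule: dec_induct)
  case (step n)
  have "ln (real (Suc n) / real n) \<le> real (Suc n) / real n - 1"
    using step by (intro ln_le_minus_one) auto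
  then have "real n * (ln (real (Suc n)) - ln (real n)) \<le> 1"
    using step by (simp add: ln_div field_simps)
  then show ?case using step.IH by (simp add: algebra_simps)
qed simp

text \<open>Dropping the 1 inside the logarithm leaves \<open>ln (n!)\<close>. This side is needed
  for \<epsilon> to tend to 0, since \<epsilon> is defined from \<open>mean_log\<close>
  exactly.\<close>

lemma mean_log_ge:
  assumes "n \<ge> 1"
  shows "ln (real n) - 2 \<le> mean_log n"
proof -
  have "real n * (ln (real n) - 2) \<le> 2 * (\<Sum>j<n. ln (real (Suc j))) - real n * ln (real n)"
    using sum_ln_ge[OF assms] by (simp add: algebra_simps)
  also have "\<dots> = (\<Sum>j<n. 2 * ln (real (Suc j)) - ln (real n))"
    by (simp add: sum_subtractf sum_distrib_left)
  also have "\<dots> \<le> (\<Sum>j<n. ln (1 + (real (Suc j))\<^sup>2 / real n))"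
  proof (rule sum_mono)
    fix j
    have "2 * ln (real (Suc j)) - ln (real n) = ln ((real (Suc j))\<^sup>2 / real n)"
      using assms by (simp add: ln_div ln_realpow del: of_nat_Suc)
    also have "\<dots> \<le> ln (1 + (real (Suc j))\<^sup>2 / real n)"
      using assms by (intro ln_mono) (auto simp del: of_nat_Suc)
    finally show "2 * ln (real (Suc j)) - ln (real n) \<le> ln (1 + (real (Suc j))\<^sup>2 / real n)" .
  qed
  finally show ?thesis using assms by (simp add: field_simps)
qed

lemma mean_log_le:
  assumes "n \<ge> 1"
  shows "mean_log n \<le> ln (real n) - 2 + 2 * (1 + ln (real n)) / real n
    + 2 * (1 + ln (real n)) / sqrt (real n)"
proof -
  have term_le: "ln (1 + (real (Suc j))\<^sup>2 / real n)
      \<le> 2 * ln (real (Suc j)) - ln (real n) + 2 * sqrt (real n) * (1 / real (Suc j))" for j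
  proof -
    define k where "k = real (Suc j)"
    define s where "s = sqrt (real n)"
    have k: "k > 0" and s: "s > 0" "real n = s\<^sup>2" using assms by (auto simp: k_def s_def)
    \<comment> \<open>This is \<open>1 + t^2 <= (1 + t)^2\<close> with \<open>t = k / s\<close>. The
      direct estimate \<open>ln (1 + n / k^2) <= n / k^2\<close> would sum to order
      \<open>n\<close>, too much; here the harmonic sum gives only order
      \<open>sqrt n * ln n\<close>.\<close>
    have "1 + k\<^sup>2 / s\<^sup>2 \<le> (k / s)\<^sup>2 * (1 + s / k)\<^sup>2"
      using k s by (simp add: field_simps power2_eq_square)
    then have "ln (1 + k\<^sup>2 / s\<^sup>2) \<le> ln ((k / s)\<^sup>2 * (1 + s / k)\<^sup>2)"
      using k s by (intro ln_mono) (auto intro: add_pos_nonneg)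
    also have "\<dots> = 2 * ln k - ln (s\<^sup>2) + 2 * ln (1 + s / k)"
    proof -
      have "0 < 1 + s / k" using k s by (simp add: add_pos_pos)
      then show ?thesis using k s by (simp add: ln_mult ln_div ln_realpow)
    qed
    also have "\<dots> \<le> 2 * ln k - ln (s\<^sup>2) + 2 * (s / k)"
      using k s by (intro add_left_mono mult_left_mono ln_add_one_self_le_self) auto
    finally show ?thesis unfolding s(2)[symmetric] k_def s_def by simp
  qed
  have "(\<Sum>j<n. ln (1 + (real (Suc j))\<^sup>2 / real n))
      \<le> (\<Sum>j<n. 2 * ln (real (Suc j)) - ln (real n) + 2 * sqrt (real n) * (1 / real (Suc j)))"
    by (intro sum_mono term_le)
  also have "\<dots> = 2 * (\<Sum>j<n. ln (real (Suc j))) - real n * ln (real n)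
      + 2 * sqrt (real n) * (\<Sum>j<n. 1 / real (Suc j))"
    by (simp add: sum.distrib sum_subtractf sum_distrib_left)
  also have "\<dots> \<le> 2 * (real n * ln (real n) - real n + 1 + ln (real n)) - real n * ln (real n)
      + 2 * sqrt (real n) * (1 + ln (real n))"
    by (intro add_mono diff_right_mono mult_left_mono sum_ln_le sum_inverse_le_ln assms) auto
  also have "\<dots> = real n * (ln (real n) - 2 + 2 * (1 + ln (real n)) / real n
    + 2 * (1 + ln (real n)) / sqrt (real n))"
  proof -
    define s where "s = sqrt (real n)"
    have s: "s > 0" "real n = s * s" using assms by (auto simp: s_def)
    show ?thesis unfolding s_def[symmetric] unfolding s(2) using s(1) by (simp add: field_simps)
  qed
  finally show ?thesis using assms by (simp add: divide_le_eq mult.commute)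
qed

lemma mean_log_asymp: "(\<lambda>n. mean_log n - ln (real n) + 2) \<longlonglongrightarrow> 0"
proof (rule tendsto_sandwich)
  show "\<forall>\<^sub>F n in sequentially. 0 \<le> mean_log n - ln (real n) + 2"
    using eventually_ge_at_top[of 1] by eventually_elim (use mean_log_ge in force)
  show "\<forall>\<^sub>F n in sequentially. mean_log n - ln (real n) + 2 \<le>
      2 * (1 + ln (real n)) / real n + 2 * (1 + ln (real n)) / sqrt (real n)"
    using eventually_ge_at_top[of 1] by eventually_elim (use mean_log_le in force)
  show "(\<lambda>n. 2 * (1 + ln (real n)) / real n + 2 * (1 + ln (real n)) / sqrt (real n)) \<longlonglongrightarrow> 0"
    by real_asymp
qed simp

theorem theorem2:
  "\<exists>\<epsilon> :: nat \<Rightarrow> real. \<epsilon> \<longlonglongrightarrow> 0 \<and>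
     (\<forall>n. real (F n) \<le> ((1 + \<epsilon> n) * (real n / (exp 1)\<^sup>2)) powr ((real n)\<^sup>2 / 2))"
proof (intro exI conjI allI)
  \<comment> \<open>Chosen so that \<open>(1 + ?eps n) * n / e^2\<close> equals
    \<open>exp (mean_log n)\<close> for every \<open>n >= 1\<close>, not just
    asymptotically.\<close>
  let ?eps = "\<lambda>n. exp (mean_log n - ln (real n) + 2) - 1"
  have "?eps \<longlonglongrightarrow> exp 0 - 1" by (intro tendsto_diff tendsto_exp mean_log_asymp tendsto_const)
  then show "?eps \<longlonglongrightarrow> 0" by simp
  fix n
  show "real (F n) \<le> ((1 + ?eps n) * (real n / (exp 1)\<^sup>2)) powr ((real n)\<^sup>2 / 2)"
  proof (cases "n = 0")
    case True
    \<comment> \<open>No partition has -1 classes. The value 0 matters, because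
      \<open>0 powr 0 = 0\<close> on the right.\<close>
    then have "F n = 0" by (simp add: F_def one_factorizations_def)
    then show ?thesis by simp
  next
    case False
    then have n: "n \<ge> 1" by simp
    have "exp 2 = (exp 1 :: real)\<^sup>2" by (simp add: exp_double[symmetric])
    then have "(1 + ?eps n) * (real n / (exp 1)\<^sup>2) = exp (mean_log n)"
      using n by (simp add: exp_diff exp_add)
    then have rhs: "((1 + ?eps n) * (real n / (exp 1)\<^sup>2)) powr ((real n)\<^sup>2 / 2)
        = exp ((real n)\<^sup>2 / 2 * mean_log n)"
      by (simp add: powr_def)
    have "real (F n) \<le> card (factor_colourings n)" using F_le_card_factor_colourings[OF n] by simp
    also have "\<dots> \<le> exp ((real n)\<^sup>2 / 2 * mean_log n)"
    \<comment> \<open>The logarithmic bound needs a colouring to exist; there is none for odd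
      \<open>n >= 3\<close>.\<close>
    proof (cases "factor_colourings n = {}")
      case False
      then have "0 < real (card (factor_colourings n))"
        by (simp add: card_gt_0_iff finite_factor_colourings)
      then show ?thesis using ln_card_factor_colourings_le[OF n False] 
        by (metis exp_le_cancel_iff exp_ln)
    qed simp
    finally show ?thesis unfolding rhs .
  qed
qed

end
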